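(* Let $\mathcal G$ be a compact, connected, finite metric graph with vertex set $\mathsf V$, edge set $\mathsf E$ and edge lengths $(\ell_{\mathsf e})_{\mathsf e\in\mathsf E}$, let $\emptyset\neq\mathsf V_{\mathrm D}\subset\mathsf V$ be the set of Dirichlet vertices and $\mathsf V_{\mathrm N}=\mathsf V\setminus\mathsf V_{\mathrm D}$. Let $v$ be the torsion function of $\mathcal G$ (with respect to $\mathsf V_{\mathrm D}$). Then the restriction $g:=v_{|\mathsf V}:\mathsf V\to\mathbb R$ is the unique solution of the system \[ \begin{cases} g(\mathsf v)=0, & \mathsf v\in\mathsf V_{\mathrm D},\\[4pt] \displaystyle \frac{1}{d^\ell_{\mathsf v}}\sum_{\mathsf e=\{\mathsf v,\mathsf w\}\in\mathsf E_{\mathsf v}}\frac{g(\mathsf v)-g(\mathsf w)}{\ell_{\mathsf e}}=\frac12, & \mathsf v\in\mathsf V_{\mathrm N},\end{cases} \] where $\mathsf E_{\mathsf v}$ is the set of edges incident to $\mathsf v$ and $d^\ell_{\mathsf v}:=\sum_{\mathsf e\in\mathsf E_{\mathsf v}}\ell_{\mathsf e}$ is the metric degree of $\mathsf v$.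
   Context: A compact, connected, finite metric graph $\mathcal G$ consists of finitely many edges $\mathsf e\simeq[0,\ell_{\mathsf e}]$, $0<\ell_{\mathsf e}<\infty$, glued at their endpoints (the vertices) to form a connected space; loops and multiple edges are allowed. In sums over $\mathsf E_{\mathsf v}$ a loop at $\mathsf v$ is counted twice (so a loop contributes $2\ell_{\mathsf e}$ to $d^\ell_{\mathsf v}$). The torsion function $v$ of $\mathcal G$ is the unique function that is continuous on $\mathcal G$, lies in $H^2(0,\ell_{\mathsf e})$ on each edge, satisfies $-v_{\mathsf e}''=1$ on every edge, vanishes at every vertex in $\mathsf V_{\mathrm D}$, and satisfies the Kirchhoff condition $\sum_{\mathsf e\in\mathsf E_{\mathsf v}}\frac{\partial v_{\mathsf e}}{\partial n}(\mathsf v)=0$ at every $\mathsf v\in\mathsf V_{\mathrm N}$. *)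

theory Defs
  imports "HOL-Analysis.Analysis" "Graph_Theory.Digraph"
begin

text \<open>
  The combinatorial graph is a finite multigraph with loops. The direction of an arc \<^term>\<open>e\<close> only
  records the identification of the edge with \<^term>\<open>{0..len e}\<close>: the tail sits at \<^term>\<open>0::real\<close>,
  the head at \<^term>\<open>len e\<close>. Reversing an arc gives the same metric graph.
\<close>

datatype ('v, 'e) point = Vertex 'v | Inner 'e real

definition edge_point :: "('v, 'e) pre_digraph \<Rightarrow> ('e \<Rightarrow> real) \<Rightarrow> 'e \<Rightarrow> real \<Rightarrow> ('v, 'e) point" where
  "edge_point G len e x =
     (if x \<le> 0 then Vertex (tail G e) else if x \<ge> len e then Vertex (head G e) else Inner e x)"

definition points :: "('v, 'e) pre_digraph \<Rightarrow> ('e \<Rightarrow> real) \<Rightarrow> ('v, 'e) point set" where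
  "points G len = Vertex ` verts G \<union> (\<Union>e\<in>arcs G. edge_point G len e ` {0..len e})"

text \<open>
  The quotient topology of the disjoint union of the intervals \<^term>\<open>{0..len e}\<close> (and of the
  vertices) under gluing: a set is open iff its preimage in every closed edge is open.
\<close>

definition graph_topology :: "('v, 'e) pre_digraph \<Rightarrow> ('e \<Rightarrow> real) \<Rightarrow> ('v, 'e) point topology" where
  "graph_topology G len = topology (\<lambda>U. U \<subseteq> points G len \<and>
     (\<forall>e\<in>arcs G. openin (top_of_set {0..len e}) {x \<in> {0..len e}. edge_point G len e x \<in> U}))"

lemma istopology_graph:
  "istopology (\<lambda>U. U \<subseteq> points G len \<and>
     (\<forall>e\<in>arcs G. openin (top_of_set {0..len e}) {x \<in> {0..len e}. edge_point G len e x \<in> U}))"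
proof -
  define pre where "pre = (\<lambda>e U. {x \<in> {0..len e}. edge_point G len e x \<in> U})"
  have Int: "pre e (S \<inter> T) = pre e S \<inter> pre e T" for e S T
    unfolding pre_def by blast
  have Union: "pre e (\<Union>K) = \<Union>(pre e ` K)" for e K
    unfolding pre_def by blast
  have "istopology (\<lambda>U. U \<subseteq> points G len \<and>
     (\<forall>e\<in>arcs G. openin (top_of_set {0..len e}) (pre e U)))"
    unfolding istopology_def Int Union by (blast intro: openin_Int openin_Union)
  then show ?thesis unfolding pre_def .
qed

lemma openin_graph_topology:
  "openin (graph_topology G len) U \<longleftrightarrow> U \<subseteq> points G len \<and>
     (\<forall>e\<in>arcs G. openin (top_of_set {0..len e}) {x \<in> {0..len e}. edge_point G len e x \<in> U})"
  unfolding graph_topology_def by (subst topology_inverse'[OF istopology_graph]) (rule refl)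

locale metric_graph = fin_digraph G
  for G :: "('v, 'e) pre_digraph" +
  fixes len :: "'e \<Rightarrow> real"
  assumes len_pos: "e \<in> arcs G \<Longrightarrow> 0 < len e"
    and connected_graph: "connected_space (graph_topology G len)"

definition test_function :: "real \<Rightarrow> real \<Rightarrow> (real \<Rightarrow> real) \<Rightarrow> bool" where
  "test_function a b \<phi> \<longleftrightarrow>
     (\<forall>n x. (deriv ^^ n) \<phi> field_differentiable at x) \<and>
     compact (closure {x. \<phi> x \<noteq> 0}) \<and> closure {x. \<phi> x \<noteq> 0} \<subseteq> {a<..<b}"

definition square_integrable :: "real \<Rightarrow> real \<Rightarrow> (real \<Rightarrow> real) \<Rightarrow> bool" where
  "square_integrable a b w \<longleftrightarrow>
     w \<in> borel_measurable (lebesgue_on {a<..<b}) \<and>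
     integrable (lebesgue_on {a<..<b}) (\<lambda>x. (w x)\<^sup>2)"

text \<open>Both \<^term>\<open>w\<close> and its weak derivative \<^term>\<open>w'\<close> are required to be square integrable.\<close>

definition weak_deriv :: "real \<Rightarrow> real \<Rightarrow> (real \<Rightarrow> real) \<Rightarrow> (real \<Rightarrow> real) \<Rightarrow> bool" where
  "weak_deriv a b w w' \<longleftrightarrow>
     square_integrable a b w \<and> square_integrable a b w' \<and>
     (\<forall>\<phi>. test_function a b \<phi> \<longrightarrow>
        (LINT x|lebesgue_on {a<..<b}. w x * deriv \<phi> x) =
        - (LINT x|lebesgue_on {a<..<b}. w' x * \<phi> x))"

definition sobolev_H2 :: "real \<Rightarrow> real \<Rightarrow> (real \<Rightarrow> real) set" where
  "sobolev_H2 a b = {w. \<exists>w1 w2. weak_deriv a b w w1 \<and> weak_deriv a b w1 w2}"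

text \<open>
  Outward normal derivatives at the two ends of an edge. A continuous function in \<open>H\<^sup>2(0, \<ell>)\<close> is
  \<open>C\<^sup>1\<close> up to the boundary, so the trace of its derivative is the one-sided derivative.
\<close>

definition normal_deriv_tail :: "real \<Rightarrow> (real \<Rightarrow> real) \<Rightarrow> real" where
  "normal_deriv_tail l w = - vector_derivative w (at 0 within {0..l})"

definition normal_deriv_head :: "real \<Rightarrow> (real \<Rightarrow> real) \<Rightarrow> real" where
  "normal_deriv_head l w = vector_derivative w (at l within {0..l})"

text \<open>
  Sums over the edges incident to \<^term>\<open>v\<close> are split into arcs leaving and arcs entering \<^term>\<open>v\<close>;
  a loop belongs to both sets, hence is counted twice.
\<close>

definition torsion_function ::
    "('v, 'e) pre_digraph \<Rightarrow> ('e \<Rightarrow> real) \<Rightarrow> 'v set \<Rightarrow> (('v, 'e) point \<Rightarrow> real) \<Rightarrow> bool" where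
  "torsion_function G len VD u \<longleftrightarrow>
     continuous_map (graph_topology G len) euclideanreal u \<and>
     (\<forall>e\<in>arcs G. u \<circ> edge_point G len e \<in> sobolev_H2 0 (len e)) \<and>
     (\<forall>e\<in>arcs G. \<exists>w1 w2.
        weak_deriv 0 (len e) (u \<circ> edge_point G len e) w1 \<and> weak_deriv 0 (len e) w1 w2 \<and>
        (AE x in lebesgue_on {0<..<len e}. - w2 x = 1)) \<and>
     (\<forall>v\<in>VD. u (Vertex v) = 0) \<and>
     (\<forall>v\<in>verts G - VD.
        (\<Sum>e\<in>out_arcs G v. normal_deriv_tail (len e) (u \<circ> edge_point G len e)) +
        (\<Sum>e\<in>in_arcs G v. normal_deriv_head (len e) (u \<circ> edge_point G len e)) = 0)"

definition metric_degree :: "('v, 'e) pre_digraph \<Rightarrow> ('e \<Rightarrow> real) \<Rightarrow> 'v \<Rightarrow> real" where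
  "metric_degree G len v = (\<Sum>e\<in>out_arcs G v. len e) + (\<Sum>e\<in>in_arcs G v. len e)"

definition discrete_torsion_system ::
    "('v, 'e) pre_digraph \<Rightarrow> ('e \<Rightarrow> real) \<Rightarrow> 'v set \<Rightarrow> ('v \<Rightarrow> real) \<Rightarrow> bool" where
  "discrete_torsion_system G len VD g \<longleftrightarrow>
     (\<forall>v\<in>VD. g v = 0) \<and>
     (\<forall>v\<in>verts G - VD.
        1 / metric_degree G len v *
          ((\<Sum>e\<in>out_arcs G v. (g v - g (head G e)) / len e) +
           (\<Sum>e\<in>in_arcs G v. (g v - g (tail G e)) / len e)) = 1 / 2)"

end

theory Submission
  imports Defs
begin

text \<open>
  On an edge the torsion function satisfies \<open>w'' = - 1\<close> weakly, so \<open>w x + x\<^sup>2 / 2\<close> is a continuous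
  function with vanishing weak second derivative, hence affine. Therefore the outward normal
  derivative at an end of an edge of length \<open>\<ell>\<close> is the difference quotient of the vertex values minus
  \<open>\<ell> / 2\<close>, and the Kirchhoff condition becomes the discrete system. Two solutions of that system
  differ by a function with zero Dirichlet energy vanishing on \<open>VD\<close>, which is \<open>0\<close> by connectedness.
\<close>

section \<open>Smooth functions and test functions\<close>

text \<open>The smoothness clause of \<open>test_function\<close>, separated from the support
  condition.\<close>

definition smooth :: "(real \<Rightarrow> real) \<Rightarrow> bool" where
  "smooth f \<longleftrightarrow> (\<forall>n x. (deriv ^^ n) f field_differentiable at x)"

text \<open>By uniqueness of derivatives the witness \<open>f'\<close> is \<open>deriv f\<close>, so
  \<open>S\<close> is stable under \<open>deriv\<close> and contains every iterated derivative of
  \<open>f\<close>.\<close>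

lemma smooth_coinduct:
  assumes "f \<in> S"
    and step: "\<And>f. f \<in> S \<Longrightarrow> \<exists>f'\<in>S. \<forall>x. (f has_field_derivative f' x) (at x)"
  shows "smooth f"
proof -
  have deriv: "deriv f \<in> S" and diff: "f field_differentiable at x" if f: "f \<in> S" for f x
  proof -
    obtain f' where f': "f' \<in> S" "\<And>x. (f has_field_derivative f' x) (at x)"
      using step[OF f] by blast
    then have "deriv f = f'"
      by (auto intro: DERIV_imp_deriv)
    with f' show "deriv f \<in> S" "f field_differentiable at x"
      by (auto simp: field_differentiable_def)
  qed
  have "(deriv ^^ n) f \<in> S" for n
    by (induction n) (use assms(1) deriv in auto)
  then show ?thesis
    unfolding smooth_def using diff by blast
qed

lemma smooth_deriv: "smooth f \<Longrightarrow> smooth (deriv f)"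
  unfolding smooth_def by (metis funpow_Suc_right o_apply)

lemma smooth_DERIV: "smooth f \<Longrightarrow> (f has_field_derivative deriv f x) (at x)"
  unfolding smooth_def
  by (metis field_differentiable_derivI funpow_0)

text \<open>Adjoining \<open>F\<close> to the smooth functions keeps the set closed under
  differentiation, because the derivative of \<open>F\<close> is already smooth.\<close>

lemma smooth_antideriv:
  assumes "\<And>x. (F has_field_derivative f x) (at x)" "smooth f"
  shows "smooth F"
proof (rule smooth_coinduct)
  show "F \<in> insert F {f. smooth f}" by simp
  show "\<exists>f'\<in>insert F {f. smooth f}. \<forall>x. (g has_field_derivative f' x) (at x)"
    if "g \<in> insert F {f. smooth f}" for g
    using that assms smooth_deriv smooth_DERIV by (metis insert_iff mem_Collect_eq)
qed

lemma continuous_on_smooth: "smooth f \<Longrightarrow> continuous_on A f"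
  by (meson DERIV_isCont continuous_at_imp_continuous_on smooth_DERIV)

text \<open>
  This set is closed under differentiation, which by coinduction makes all its members smooth; no
  Leibniz formula for higher derivatives is needed.
\<close>

inductive_set smooth_closure :: "(real \<Rightarrow> real) set" where
  const: "(\<lambda>x. c) \<in> smooth_closure"
| affine: "smooth f \<Longrightarrow> (\<lambda>x. f (a * x + b)) \<in> smooth_closure"
| add: "f \<in> smooth_closure \<Longrightarrow> g \<in> smooth_closure \<Longrightarrow> (\<lambda>x. f x + g x) \<in> smooth_closure"
| mult: "f \<in> smooth_closure \<Longrightarrow> g \<in> smooth_closure \<Longrightarrow> (\<lambda>x. f x * g x) \<in> smooth_closure"

lemma smooth_closure_imp_smooth:
  assumes "f \<in> smooth_closure"
  shows "smooth f"
  using assms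
proof (rule smooth_coinduct)
  fix f assume "f \<in> smooth_closure"
  then show "\<exists>f'\<in>smooth_closure. \<forall>x. (f has_field_derivative f' x) (at x)"
  proof induction
    case (const c)
    show ?case
      by (rule bexI[of _ "\<lambda>x. 0"]) (auto intro: smooth_closure.const)
  next
    case (affine f a b)
    have "((\<lambda>x. f (a * x + b)) has_field_derivative deriv f (a * x + b) * a) (at x)" for x
      by (rule DERIV_chain2[of f, OF smooth_DERIV[OF affine]]) (auto intro!: derivative_eq_intros)
    moreover have "(\<lambda>x. deriv f (a * x + b) * a) \<in> smooth_closure"
      by (intro smooth_closure.mult smooth_closure.affine smooth_closure.const smooth_deriv affine)
    ultimately show ?case
      by (intro bexI[of _ "\<lambda>x. deriv f (a * x + b) * a"]) auto
  next
    case (add f g)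
    then obtain f' g' where
      *: "f' \<in> smooth_closure" "g' \<in> smooth_closure"
         "\<And>x. (f has_field_derivative f' x) (at x)" "\<And>x. (g has_field_derivative g' x) (at x)"
      by blast
    then show ?case
      by (intro bexI[of _ "\<lambda>x. f' x + g' x"] smooth_closure.add) (auto intro: DERIV_add)
  next
    case (mult f g)
    then obtain f' g' where
      *: "f' \<in> smooth_closure" "g' \<in> smooth_closure"
         "\<And>x. (f has_field_derivative f' x) (at x)" "\<And>x. (g has_field_derivative g' x) (at x)"
      by blast
    have "(\<lambda>x. f' x * g x + g' x * f x) \<in> smooth_closure"
      by (intro smooth_closure.add smooth_closure.mult * mult.hyps)
    then show ?case
      using DERIV_mult[OF *(3,4)] by (intro bexI[of _ "\<lambda>x. f' x * g x + g' x * f x"]) auto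
  qed
qed

lemma smooth_imp_smooth_closure: "smooth f \<Longrightarrow> f \<in> smooth_closure"
  using smooth_closure.affine[of f 1 0] by simp

lemma smooth_add: "smooth f \<Longrightarrow> smooth g \<Longrightarrow> smooth (\<lambda>x. f x + g x)"
  by (simp add: smooth_closure_imp_smooth smooth_closure.add smooth_imp_smooth_closure)

lemma smooth_mult: "smooth f \<Longrightarrow> smooth g \<Longrightarrow> smooth (\<lambda>x. f x * g x)"
  by (simp add: smooth_closure_imp_smooth smooth_closure.mult smooth_imp_smooth_closure)

lemma smooth_cmult: "smooth f \<Longrightarrow> smooth (\<lambda>x. c * f x)"
  by (simp add: smooth_closure_imp_smooth smooth_closure.mult smooth_closure.const smooth_imp_smooth_closure)

lemma smooth_affine: "smooth f \<Longrightarrow> smooth (\<lambda>x. f (a * x + b))"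
  by (simp add: smooth_closure_imp_smooth smooth_closure.affine)

lemma smooth_shift: "smooth f \<Longrightarrow> smooth (\<lambda>x. f (x - a))"
  using smooth_affine[of f 1 "- a"] by simp

section \<open>A smooth bump function\<close>

lemma tendsto_poly_exp_0:
  fixes p :: "real poly"
  shows "((\<lambda>t. poly p t * exp (- t)) \<longlongrightarrow> 0) at_top"
proof -
  have "((\<lambda>t. \<Sum>i\<le>degree p. coeff p i * (t ^ i / exp t)) \<longlongrightarrow> (\<Sum>i\<le>degree p. coeff p i * 0)) at_top"
    by (intro tendsto_intros tendsto_power_div_exp_0)
  then show ?thesis
    by (simp add: poly_altdef sum_distrib_right exp_minus divide_inverse mult.assoc)
qed

text \<open>The classical function exp(-1/x), extended by zero. The polynomial factor in 1/x makes
  the family closed under differentiation.\<close>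

definition flat :: "real poly \<Rightarrow> real \<Rightarrow> real" where
  "flat p x = (if x > 0 then poly p (inverse x) * exp (- inverse x) else 0)"

text \<open>With t = 1/x, the derivative of p(t) exp(-t) in x is t^2 (p(t) - p'(t)) exp(-t); the
  factor \<open>[:0, 0, 1:]\<close> is t^2. At the origin exponential decay beats every
  polynomial.\<close>

lemma DERIV_flat:
  "(flat p has_field_derivative flat ([:0, 0, 1:] * (p - pderiv p)) x) (at x)"
proof (cases x "0::real" rule: linorder_cases)
  case less
  have "((\<lambda>x. 0) has_field_derivative 0) (at x)" by simp
  then have "(flat p has_field_derivative 0) (at x)"
    by (rule has_field_derivative_transform_within_open[of _ _ _ "{..<0}"])
       (use less in \<open>auto simp: flat_def\<close>)
  then show ?thesis using less by (simp add: flat_def)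
next
  case greater
  have "((\<lambda>x. poly p (inverse x) * exp (- inverse x)) has_field_derivative
      flat ([:0, 0, 1:] * (p - pderiv p)) x) (at x)"
    using greater
    by (auto intro!: derivative_eq_intros DERIV_chain2[OF poly_DERIV]
        simp: flat_def power2_eq_square algebra_simps)
  then show ?thesis
    by (rule has_field_derivative_transform_within_open[of _ _ _ "{0<..}"])
       (use greater in \<open>auto simp: flat_def\<close>)
next
  case equal
  \<comment> \<open>Dividing by \<open>h\<close> multiplies the polynomial by its variable, which is
    what \<open>pCons 0\<close> does.\<close>
  have "((\<lambda>h. poly (pCons 0 p) (inverse h) * exp (- inverse h)) \<longlongrightarrow> 0) (at_right 0)"
    by (rule filterlim_compose[OF tendsto_poly_exp_0 filterlim_inverse_at_top_right])
  then have "((\<lambda>h. flat p h / h) \<longlongrightarrow> 0) (at_right 0)"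
    by (rule Lim_transform_eventually)
       (auto simp: eventually_at_filter flat_def divide_inverse)
  moreover have "((\<lambda>h. flat p h / h) \<longlongrightarrow> 0) (at_left 0)"
    by (rule Lim_transform_eventually[of "\<lambda>_. 0"])
       (auto simp: eventually_at_filter flat_def)
  ultimately have "((\<lambda>h. flat p h / h) \<longlongrightarrow> 0) (at 0)"
    by (simp add: filterlim_split_at)
  then show ?thesis
    using equal by (simp add: DERIV_def flat_def)
qed

lemma smooth_flat: "smooth (flat p)"
  by (rule smooth_coinduct[of _ "range flat"]) (use DERIV_flat in blast)+

lemma bump_exists:
  assumes "\<epsilon> > 0"
  obtains \<eta> where "smooth \<eta>" "\<And>x. \<eta> x \<ge> 0" "\<And>x. \<bar>x\<bar> \<ge> \<epsilon> \<Longrightarrow> \<eta> x = 0" "\<eta> 0 > 0"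
proof
  \<comment> \<open>The first factor vanishes left of \<open>- \<epsilon>\<close>, the second right
    of \<open>\<epsilon>\<close>; the arguments are written in the shape of
    \<open>smooth_affine\<close>.\<close>
  let ?\<eta> = "\<lambda>x. flat 1 (1 * x + \<epsilon>) * flat 1 (- 1 * x + \<epsilon>)"
  show "smooth ?\<eta>"
    by (intro smooth_mult smooth_affine smooth_flat)
qed (use assms in \<open>auto simp: flat_def\<close>)

text \<open>Normalising an antiderivative to vanish at \<open>a\<close> suffices: it is constant to
  the left of \<open>a\<close>, where \<open>f\<close> is zero.\<close>

lemma antideriv_vanishing_left:
  assumes "smooth f" "\<And>x. x \<le> a \<Longrightarrow> f x = 0"
  obtains F where "smooth F" "\<And>x. (F has_field_derivative f x) (at x)" "\<And>x. x \<le> a \<Longrightarrow> F x = 0"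
proof -
  have "isCont f x" for x
    using DERIV_isCont smooth_DERIV[OF assms(1)] by blast
  then obtain F0 where F0: "\<And>x. (F0 has_field_derivative f x) (at x)"
    using einterval_antiderivative[of "-\<infinity>" "\<infinity>" f]
    by (auto simp: has_real_derivative_iff_has_vector_derivative)
  define F where "F = (\<lambda>x. F0 x - F0 a)"
  have F: "(F has_field_derivative f x) (at x)" for x
    unfolding F_def using F0 by (auto intro!: derivative_eq_intros)
  have "F x = 0" if "x \<le> a" for x
  proof (cases "x = a")
    case False
    have "F a = F x"
    proof (rule DERIV_isconst_end[of x a F])
      show "x < a" using that False by simp
      show "continuous_on {x..a} F"
        by (meson DERIV_isCont F continuous_at_imp_continuous_on)
      show "(F has_field_derivative 0) (at y)" if "y < a" for y
        using F[of y] assms(2)[of y] that by simp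
    qed
    then show ?thesis by (simp add: F_def)
  qed (simp add: F_def)
  then show thesis
    by (intro that[OF smooth_antideriv[OF F assms(1)] F])
qed

section \<open>Test functions\<close>

lemma test_function_iff:
  "test_function a b \<phi> \<longleftrightarrow>
     smooth \<phi> \<and> compact (closure {x. \<phi> x \<noteq> 0}) \<and> closure {x. \<phi> x \<noteq> 0} \<subseteq> {a<..<b}"
  by (simp add: test_function_def smooth_def)

lemma test_functionI:
  assumes "smooth \<phi>" "a < c" "d < b" "\<And>x. x \<notin> {c..d} \<Longrightarrow> \<phi> x = 0"
  shows "test_function a b \<phi>"
proof -
  have "closure {x. \<phi> x \<noteq> 0} \<subseteq> {c..d}"
    using assms(4) by (intro closure_minimal) (blast, simp)
  then show ?thesis
    using assms unfolding test_function_iff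
    by (auto intro: bounded_subset[of "{c..d}"] bounded_subset[OF bounded_closure] simp: compact_eq_bounded_closed)
qed

text \<open>Off its support \<open>\<phi>\<close> is zero on an open set, hence so is its
  derivative; differentiation cannot enlarge the support.\<close>

lemma test_function_deriv:
  assumes "test_function a b \<phi>"
  shows "test_function a b (deriv \<phi>)"
proof -
  have "deriv \<phi> x = 0" if "x \<notin> closure {x. \<phi> x \<noteq> 0}" for x
  proof -
    have "((\<lambda>x. 0) has_field_derivative 0) (at x)" by simp
    then have "(\<phi> has_field_derivative 0) (at x)"
      by (rule has_field_derivative_transform_within_open[of _ _ _ "- closure {x. \<phi> x \<noteq> 0}"])
         (use that closure_subset[of "{x. \<phi> x \<noteq> 0}"] in auto)
    then show ?thesis by (rule DERIV_imp_deriv)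
  qed
  then have "closure {x. deriv \<phi> x \<noteq> 0} \<subseteq> closure {x. \<phi> x \<noteq> 0}"
    by (intro closure_minimal) auto
  then show ?thesis
    using assms unfolding test_function_iff
    by (auto intro: smooth_deriv bounded_subset simp: compact_eq_bounded_closed)
qed

lemma test_function_outside:
  assumes "test_function a b \<phi>" "x \<notin> {a<..<b}"
  shows "\<phi> x = 0"
  using assms closure_subset[of "{x. \<phi> x \<noteq> 0}"] unfolding test_function_iff by blast

section \<open>Functions with vanishing weak second derivative\<close>

text \<open>
  The second difference of \<open>f\<close> at \<open>p\<close>, \<open>q\<close>, \<open>r\<close> is tested against the combination of three translates
  of a twofold antiderivative of the bump \<open>\<eta>\<close>. To the right of the support of the bumps these
  antiderivatives are affine, so the combination vanishes there too.
\<close>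

lemma mollified_three_point_identity:
  fixes f :: "real \<Rightarrow> real"
  assumes cont: "continuous_on {0..l} f"
    and orth: "\<And>\<phi>. test_function 0 l \<phi> \<Longrightarrow> integral {0..l} (\<lambda>x. f x * deriv (deriv \<phi>) x) = 0"
    and \<epsilon>: "\<epsilon> > 0" "{p - 2 * \<epsilon>..p + 2 * \<epsilon>} \<subseteq> {0..l}" "{q - 2 * \<epsilon>..q + 2 * \<epsilon>} \<subseteq> {0..l}" "{r - 2 * \<epsilon>..r + 2 * \<epsilon>} \<subseteq> {0..l}"
    and \<eta>: "smooth \<eta>" "\<And>x. \<bar>x\<bar> \<ge> \<epsilon> \<Longrightarrow> \<eta> x = 0"
  defines "H \<equiv> \<lambda>t. (r - q) * f (t + p) + (p - r) * f (t + q) + (q - p) * f (t + r)"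
  shows "continuous_on {- \<epsilon>..\<epsilon>} H" "integral {- \<epsilon>..\<epsilon>} (\<lambda>t. H t * \<eta> t) = 0"
proof -
  \<comment> \<open>The margin is twice the bump radius, so that the combination below vanishes
    outside \<open>{\<epsilon>..l - \<epsilon>}\<close>, away from both ends.\<close>
  have \<epsilon>: "\<epsilon> > 0" "2 * \<epsilon> \<le> p" "2 * \<epsilon> \<le> q" "2 * \<epsilon> \<le> r" "p \<le> l - 2 * \<epsilon>" "q \<le> l - 2 * \<epsilon>" "r \<le> l - 2 * \<epsilon>"
    using \<epsilon> by (auto simp: atLeastatMost_subset_iff)
  obtain S where S: "smooth S" "\<And>x. (S has_field_derivative \<eta> x) (at x)" "\<And>x. x \<le> - \<epsilon> \<Longrightarrow> S x = 0"
    by (rule antideriv_vanishing_left[OF \<eta>(1), of "- \<epsilon>"]) (use \<eta>(2) \<epsilon>(1) in auto)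
  obtain \<Phi> where \<Phi>: "smooth \<Phi>" "\<And>x. (\<Phi> has_field_derivative S x) (at x)" "\<And>x. x \<le> - \<epsilon> \<Longrightarrow> \<Phi> x = 0"
    by (rule antideriv_vanishing_left[OF S(1), of "- \<epsilon>"]) (use S(3) in auto)
  have S_const: "S x = S \<epsilon>" if "x \<ge> \<epsilon>" for x
  proof (cases "x = \<epsilon>")
    case False
    show ?thesis
    proof (rule DERIV_isconst_end[of \<epsilon> x S])
      show "\<epsilon> < x" using that False by simp
      show "continuous_on {\<epsilon>..x} S"
        by (rule continuous_on_smooth[OF S(1)])
      show "(S has_field_derivative 0) (at y)" if "\<epsilon> < y" for y
        using S(2)[of y] \<eta>(2)[of y] that by simp
    qed
  qed simp
  have \<Phi>_affine: "\<Phi> x = S \<epsilon> * (x - \<epsilon>) + \<Phi> \<epsilon>" if "x \<ge> \<epsilon>" for x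
  proof (cases "x = \<epsilon>")
    case False
    have "\<Phi> x - S \<epsilon> * x = \<Phi> \<epsilon> - S \<epsilon> * \<epsilon>"
    proof (rule DERIV_isconst_end[of \<epsilon> x "\<lambda>x. \<Phi> x - S \<epsilon> * x"])
      show "\<epsilon> < x" using that False by simp
      show "continuous_on {\<epsilon>..x} (\<lambda>x. \<Phi> x - S \<epsilon> * x)"
        by (intro continuous_intros continuous_on_smooth[OF \<Phi>(1)])
      show "((\<lambda>x. \<Phi> x - S \<epsilon> * x) has_field_derivative 0) (at y)" if "\<epsilon> < y" for y
        using S_const[of y] that by (auto intro!: derivative_eq_intros \<Phi>(2))
    qed
    then show ?thesis by (simp add: algebra_simps)
  qed simp
  \<comment> \<open>The second difference as an operator on functions; it commutes with
    differentiation, so the second derivative of \<open>comb \<Phi>\<close> is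
    \<open>comb \<eta>\<close>.\<close>
  define comb where "comb = (\<lambda>g x. (r - q) * g (x - p) + (p - r) * g (x - q) + (q - p) * g (x - r) :: real)"
  have "smooth (comb \<Phi>)"
    unfolding comb_def
    by (intro smooth_add smooth_cmult smooth_shift \<Phi>(1))
  moreover have "comb \<Phi> x = 0" if "x \<notin> {\<epsilon>..l - \<epsilon>}" for x
  proof (cases "x < \<epsilon>")
    case True
    then show ?thesis using \<epsilon> by (simp add: comb_def \<Phi>(3))
  next
    case False
    then have "x - p \<ge> \<epsilon>" "x - q \<ge> \<epsilon>" "x - r \<ge> \<epsilon>" using \<epsilon> that by auto
    \<comment> \<open>The weights \<open>r - q\<close>, \<open>p - r\<close>, \<open>q - p\<close>
      sum to zero and so do their products with \<open>p\<close>, \<open>q\<close>,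
      \<open>r\<close>, hence \<open>comb\<close> annihilates affine functions.\<close>
    from this[THEN \<Phi>_affine] show ?thesis
      unfolding comb_def by algebra
  qed
  ultimately have test: "test_function 0 l (comb \<Phi>)"
    using \<epsilon>(1) by (intro test_functionI[of _ _ \<epsilon> "l - \<epsilon>"]) auto
  have comb_deriv: "deriv (comb g) = comb g'"
    if g: "\<And>x. (g has_field_derivative g' x) (at x)" for g g'
  proof (rule ext, rule DERIV_imp_deriv)
    fix x
    have shift: "((\<lambda>x. g (x - a)) has_field_derivative g' (x - a)) (at x)" for a
      using g[of "x - a"] DERIV_shift[of g "g' (x - a)" x "- a"] by simp
    show "(comb g has_field_derivative comb g' x) (at x)"
      unfolding comb_def by (intro DERIV_add DERIV_cmult shift)
  qed
  have "deriv (deriv (comb \<Phi>)) = comb \<eta>"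
    by (simp add: comb_deriv[OF \<Phi>(2)] comb_deriv[OF S(2)])
  then have zero: "integral {0..l} (\<lambda>x. f x * comb \<eta> x) = 0"
    using orth[OF test] by simp

  have sub: "{y - \<epsilon>..y + \<epsilon>} \<subseteq> {0..l}" if "y \<in> {p, q, r}" for y
    using that \<epsilon> by auto
  \<comment> \<open>The substitution x = t + y moves the translated bump back to the origin, so that
    all three integrals run over \<open>{- \<epsilon>..\<epsilon>}\<close>.\<close>
  have translate: "((\<lambda>x. f x * \<eta> (x - y)) has_integral
      integral {- \<epsilon>..\<epsilon>} (\<lambda>t. f (t + y) * \<eta> t)) {0..l}" if y: "y \<in> {p, q, r}" for y
  proof (rule has_integral_on_superset[OF _ _ sub[OF y]])
    have cont': "continuous_on {y - \<epsilon>..y + \<epsilon>} (\<lambda>x. f x * \<eta> (x - y))"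
      by (intro continuous_intros continuous_on_subset[OF cont sub[OF y]]
          continuous_on_compose2[OF continuous_on_smooth[OF \<eta>(1), of UNIV]]) auto
    then have "integral {- \<epsilon>..\<epsilon>} (\<lambda>t. f (t + y) * \<eta> t) = integral {y - \<epsilon>..y + \<epsilon>} (\<lambda>x. f x * \<eta> (x - y))"
      using integral_shift_real_ivl[of "y - \<epsilon>" y "y + \<epsilon>" "\<lambda>x. f x * \<eta> (x - y)"] by simp
    with cont' show "((\<lambda>x. f x * \<eta> (x - y)) has_integral
        integral {- \<epsilon>..\<epsilon>} (\<lambda>t. f (t + y) * \<eta> t)) {y - \<epsilon>..y + \<epsilon>}"
      by (simp add: has_integral_integral[symmetric] integrable_continuous_interval)
  next
    fix x assume "x \<notin> {y - \<epsilon>..y + \<epsilon>}"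
    then have "\<bar>x - y\<bar> \<ge> \<epsilon>" by auto
    then show "f x * \<eta> (x - y) = 0"
      by (simp add: \<eta>(2))
  qed
  have cont_y: "continuous_on {- \<epsilon>..\<epsilon>} (\<lambda>t. f (t + y))" if y: "y \<in> {p, q, r}" for y
    by (rule continuous_on_compose2[OF cont]) (use y \<epsilon> in \<open>auto intro!: continuous_intros\<close>)
  then show "continuous_on {- \<epsilon>..\<epsilon>} H"
    unfolding H_def by (intro continuous_intros) auto
  have int_y: "(\<lambda>t. f (t + y) * \<eta> t) integrable_on {- \<epsilon>..\<epsilon>}" if "y \<in> {p, q, r}" for y
    by (intro integrable_continuous_real continuous_intros cont_y that continuous_on_smooth \<eta>(1))
  let ?I = "\<lambda>y. integral {- \<epsilon>..\<epsilon>} (\<lambda>t. f (t + y) * \<eta> t)"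
  have "((\<lambda>x. (r - q) * (f x * \<eta> (x - p)) + (p - r) * (f x * \<eta> (x - q)) + (q - p) * (f x * \<eta> (x - r)))
      has_integral ((r - q) * ?I p + (p - r) * ?I q + (q - p) * ?I r)) {0..l}"
    by (intro has_integral_add has_integral_mult_right translate) auto
  then have "(r - q) * ?I p + (p - r) * ?I q + (q - p) * ?I r = integral {0..l} (\<lambda>x. f x * comb \<eta> x)"
    by (simp add: has_integral_iff comb_def algebra_simps)
  moreover have "((\<lambda>t. (r - q) * (f (t + p) * \<eta> t) + (p - r) * (f (t + q) * \<eta> t) + (q - p) * (f (t + r) * \<eta> t))
      has_integral ((r - q) * ?I p + (p - r) * ?I q + (q - p) * ?I r)) {- \<epsilon>..\<epsilon>}"
    by (intro has_integral_add has_integral_mult_right integrable_integral int_y) auto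
  ultimately have "((\<lambda>t. H t * \<eta> t) has_integral 0) {- \<epsilon>..\<epsilon>}"
    using zero by (simp add: H_def algebra_simps)
  then show "integral {- \<epsilon>..\<epsilon>} (\<lambda>t. H t * \<eta> t) = 0"
    by (rule integral_unique)
qed

text \<open>The identity says that the three points on the graph of \<open>f\<close> are collinear.
  If it failed, \<open>H\<close> would keep its sign near zero, and its integral against a narrow
  nonnegative bump could not vanish.\<close>

lemma three_point_identity:
  fixes f :: "real \<Rightarrow> real"
  assumes cont: "continuous_on {0..l} f"
    and orth: "\<And>\<phi>. test_function 0 l \<phi> \<Longrightarrow> integral {0..l} (\<lambda>x. f x * deriv (deriv \<phi>) x) = 0"
    and pqr: "p \<in> {0<..<l}" "q \<in> {0<..<l}" "r \<in> {0<..<l}"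
  shows "(r - q) * f p + (p - r) * f q + (q - p) * f r = 0"
proof (rule ccontr)
  define H where "H = (\<lambda>t. (r - q) * f (t + p) + (p - r) * f (t + q) + (q - p) * f (t + r))"
  assume "\<not> ?thesis"
  then have "H 0 \<noteq> 0" by (simp add: H_def)
  have "isCont f y" if "y \<in> {0<..<l}" for y
    using continuous_on_interior[OF cont] that by simp
  then have "isCont (\<lambda>t. f (t + y)) 0" if "y \<in> {0<..<l}" for y
    using that by (intro continuous_intros isCont_o2[of _ "\<lambda>t. t + y"]) auto
  \<comment> \<open>Multiplying by \<open>H 0\<close> treats both signs of \<open>H 0\<close> at
    once.\<close>
  then have "isCont (\<lambda>t. H 0 * H t) 0"
    unfolding H_def using pqr by (intro continuous_intros) auto
  then have "(\<lambda>t. H 0 * H t) \<midarrow>0\<rightarrow> H 0 * H 0"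
    by (simp add: isCont_def)
  moreover have "H 0 * H 0 > 0"
    using \<open>H 0 \<noteq> 0\<close> not_real_square_gt_zero by blast
  ultimately have "\<forall>\<^sub>F t in at 0. H 0 * H t > 0"
    by (rule order_tendstoD)
  then obtain d where d: "d > 0" "\<And>t. t \<noteq> 0 \<Longrightarrow> \<bar>t\<bar> < d \<Longrightarrow> H 0 * H t > 0"
    unfolding eventually_at by auto
  \<comment> \<open>All bounds on the bump radius: the distances of the three points to the ends of
    the interval, and the range \<open>d\<close> in which \<open>H\<close> keeps its sign.\<close>
  define D where "D = {p, q, r, l - p, l - q, l - r, d}"
  define \<epsilon> where "\<epsilon> = Min D / 2"
  have D: "finite D" "D \<noteq> {}" "\<forall>x\<in>D. x > 0"
    using pqr d(1) by (auto simp: D_def)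
  have le: "2 * \<epsilon> \<le> x" if "x \<in> D" for x
    using Min_le[OF D(1) that] unfolding \<epsilon>_def by linarith
  have "Min D > 0"
    using D Min_in by blast
  then have "\<epsilon> > 0"
    by (simp add: \<epsilon>_def)
  have sub: "{y - 2 * \<epsilon>..y + 2 * \<epsilon>} \<subseteq> {0..l}" if "y \<in> {p, q, r}" for y
    using that le[of y] le[of "l - y"] by (auto simp: D_def)
  obtain \<eta> where \<eta>: "smooth \<eta>" "\<And>x. \<eta> x \<ge> 0" "\<And>x. \<bar>x\<bar> \<ge> \<epsilon> \<Longrightarrow> \<eta> x = 0" "\<eta> 0 > 0"
    using bump_exists[OF \<open>\<epsilon> > 0\<close>] by blast
  have cont_H: "continuous_on {- \<epsilon>..\<epsilon>} H" and int_H: "integral {- \<epsilon>..\<epsilon>} (\<lambda>t. H t * \<eta> t) = 0"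
    using mollified_three_point_identity[OF cont orth \<open>\<epsilon> > 0\<close> sub sub sub \<eta>(1,3), of p q r]
    by (simp_all add: H_def)
  have nonneg: "H 0 * (H t * \<eta> t) \<ge> 0" if "t \<in> {- \<epsilon>..\<epsilon>}" for t
  proof -
    have "\<bar>t\<bar> < d" using that le[of d] \<open>\<epsilon> > 0\<close> by (auto simp: D_def)
    then have "H 0 * H t \<ge> 0" using d(2)[of t] by (cases "t = 0") auto
    then show ?thesis using \<eta>(2)[of t] by (metis mult.assoc mult_nonneg_nonneg)
  qed
  have "integral {- \<epsilon>..\<epsilon>} (\<lambda>t. H 0 * (H t * \<eta> t)) = 0"
    using int_H by simp
  moreover have "continuous_on {- \<epsilon>..\<epsilon>} (\<lambda>t. H 0 * (H t * \<eta> t))"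
    by (intro continuous_intros cont_H continuous_on_smooth \<eta>(1))
  \<comment> \<open>A nonnegative continuous function with zero integral vanishes everywhere, in
    particular at \<open>t = 0\<close>.\<close>
  ultimately have "H 0 * (H 0 * \<eta> 0) = 0"
    using nonneg \<open>\<epsilon> > 0\<close> by (subst (asm) integral_eq_0_iff) auto
  then show False
    using \<open>H 0 \<noteq> 0\<close> \<eta>(4) by simp
qed

text \<open>With two interior points fixed and the third varying, the three-point identity puts the
  graph of \<open>f\<close> on the secant line through the fixed ones.\<close>

lemma affine_of_orthogonal:
  fixes f :: "real \<Rightarrow> real"
  assumes "0 < l" and cont: "continuous_on {0..l} f"
    and orth: "\<And>\<phi>. test_function 0 l \<phi> \<Longrightarrow> integral {0..l} (\<lambda>x. f x * deriv (deriv \<phi>) x) = 0"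
  obtains b c where "\<And>x. x \<in> {0..l} \<Longrightarrow> f x = b * x + c"
proof -
  define p where "p = l / 3"
  define q where "q = 2 * l / 3"
  define b where "b = (f q - f p) / (q - p)"
  define c where "c = f p - b * p"
  have pq: "p \<in> {0<..<l}" "q \<in> {0<..<l}" "q - p > 0"
    using \<open>0 < l\<close> by (auto simp: p_def q_def)
  have inner: "f x - (b * x + c) = 0" if "x \<in> {0<..<l}" for x
  proof -
    have "(x - q) * f p + (p - x) * f q + (q - p) * f x = 0"
      by (rule three_point_identity[OF cont orth pq(1,2) that])
    moreover have "b * (q - p) = f q - f p"
      using pq(3) by (simp add: b_def)
    ultimately have "(q - p) * (f x - (b * x + c)) = 0"
      unfolding c_def by algebra
    then show ?thesis using pq(3) by simp
  qed
  \<comment> \<open>The ends of the interval are reached by continuity.\<close>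
  have "f x - (b * x + c) = 0" if "x \<in> {0..l}" for x
    by (rule continuous_constant_on_closure[of "{0<..<l}" "\<lambda>x. f x - (b * x + c)"])
       (use cont inner that \<open>0 < l\<close> in \<open>auto intro!: continuous_intros\<close>)
  then show thesis
    by (intro that[of b c]) auto
qed

section \<open>The torsion function on an edge\<close>

text \<open>Connects the Lebesgue integral of \<open>weak_deriv\<close> with the gauge integral used
  for calculus; the two endpoints form a null set.\<close>

lemma lebesgue_integral_Ioo_eq_integral:
  fixes g :: "real \<Rightarrow> real"
  assumes "continuous_on {a..b} g"
  shows "(LINT x|lebesgue_on {a<..<b}. g x) = integral {a..b} g"
proof -
  have "integrable (lebesgue_on {a<..<b}) g"
    using absolutely_integrable_continuous_real[OF assms]
    by (intro absolutely_integrable_imp_integrable) (simp_all add: absolutely_integrable_on_Icc_iff_Ioo)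
  then show ?thesis
    by (simp add: lebesgue_integral_eq_integral integral_open_interval_real)
qed

lemma torsion_edge_quadratic:
  assumes "0 < l" and cont: "continuous_on {0..l} w"
    and w1: "weak_deriv 0 l w w1" and w2: "weak_deriv 0 l w1 w2"
    and AE: "AE x in lebesgue_on {0<..<l}. - w2 x = 1"
  obtains b c where "\<And>x. x \<in> {0..l} \<Longrightarrow> w x = b * x + c - x\<^sup>2 / 2"
proof -
  have "integral {0..l} (\<lambda>x. (w x + x\<^sup>2 / 2) * deriv (deriv \<phi>) x) = 0" if \<phi>: "test_function 0 l \<phi>" for \<phi>
  proof -
    note \<phi>' = test_function_deriv[OF \<phi>]
    have smooth: "smooth \<phi>" "smooth (deriv \<phi>)" "smooth (deriv (deriv \<phi>))"
      using \<phi> by (auto simp: test_function_iff intro: smooth_deriv)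
    have [measurable]: "\<phi> \<in> borel_measurable (lebesgue_on {0<..<l})"
      by (intro continuous_imp_measurable_on_sets_lebesgue continuous_on_smooth smooth) auto
    have [measurable]: "w2 \<in> borel_measurable (lebesgue_on {0<..<l})"
      using w2 by (simp add: weak_deriv_def square_integrable_def)
    have "integral {0..l} (\<lambda>x. w x * deriv (deriv \<phi>) x)
        = (LINT x|lebesgue_on {0<..<l}. w x * deriv (deriv \<phi>) x)"
      by (intro lebesgue_integral_Ioo_eq_integral[symmetric] continuous_intros cont continuous_on_smooth smooth)
    \<comment> \<open>Two weak integrations by parts, the first one tested with
      \<open>deriv \<phi>\<close>; the two signs cancel.\<close>
    also have "\<dots> = (LINT x|lebesgue_on {0<..<l}. w2 x * \<phi> x)"
      using w1 w2 \<phi> \<phi>' by (simp add: weak_deriv_def)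
    also have "\<dots> = (LINT x|lebesgue_on {0<..<l}. - \<phi> x)"
      by (rule integral_cong_AE) (use AE in \<open>auto elim!: eventually_mono\<close>)
    also have "\<dots> = integral {0..l} (\<lambda>x. - \<phi> x)"
      by (intro lebesgue_integral_Ioo_eq_integral continuous_intros continuous_on_smooth smooth)
    finally have eq: "integral {0..l} (\<lambda>x. w x * deriv (deriv \<phi>) x) = integral {0..l} (\<lambda>x. - \<phi> x)" .
    have "((\<lambda>x. w x * deriv (deriv \<phi>) x) has_integral integral {0..l} (\<lambda>x. - \<phi> x)) {0..l}"
      unfolding eq[symmetric]
      by (intro integrable_integral integrable_continuous_real continuous_intros cont continuous_on_smooth smooth)
    moreover have "((\<lambda>x. - \<phi> x) has_integral integral {0..l} (\<lambda>x. - \<phi> x)) {0..l}"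
      by (intro integrable_integral integrable_continuous_real continuous_intros continuous_on_smooth smooth)
    \<comment> \<open>The antiderivative is x^2/2 * phi'(x) - x * phi(x). Its value at
      \<open>l\<close> vanishes because \<open>\<phi>\<close> and \<open>deriv \<phi>\<close> do,
      its value at zero because of the explicit factors.\<close>
    moreover have "((\<lambda>x. x\<^sup>2 / 2 * deriv (deriv \<phi>) x - \<phi> x) has_integral
        (l\<^sup>2 / 2 * deriv \<phi> l - l * \<phi> l) - (0\<^sup>2 / 2 * deriv \<phi> 0 - 0 * \<phi> 0)) {0..l}"
      by (rule fundamental_theorem_of_calculus)
        (use \<open>0 < l\<close> in \<open>auto simp flip: has_real_derivative_iff_has_vector_derivative
          intro!: derivative_eq_intros has_field_derivative_at_within[OF smooth_DERIV] smooth simp: add_divide_distrib\<close>)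
    ultimately have "((\<lambda>x. w x * deriv (deriv \<phi>) x - - \<phi> x + (x\<^sup>2 / 2 * deriv (deriv \<phi>) x - \<phi> x)) has_integral
        (integral {0..l} (\<lambda>x. - \<phi> x) - integral {0..l} (\<lambda>x. - \<phi> x)
          + ((l\<^sup>2 / 2 * deriv \<phi> l - l * \<phi> l) - (0\<^sup>2 / 2 * deriv \<phi> 0 - 0 * \<phi> 0)))) {0..l}"
      by (intro has_integral_add[OF has_integral_diff])
    moreover have "\<phi> l = 0" "deriv \<phi> l = 0"
      using test_function_outside[OF \<phi>, of l] test_function_outside[OF \<phi>', of l] by auto
    ultimately have "((\<lambda>x. (w x + x\<^sup>2 / 2) * deriv (deriv \<phi>) x) has_integral 0) {0..l}"
      by (simp add: algebra_simps)
    then show ?thesis by (rule integral_unique)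
  qed
  then obtain b c where "w x + x\<^sup>2 / 2 = b * x + c" if "x \<in> {0..l}" for x
    by (rule affine_of_orthogonal[OF \<open>0 < l\<close>, of "\<lambda>x. w x + x\<^sup>2 / 2", rotated])
       (auto intro!: continuous_intros cont)
  then show thesis
    by (intro that[of b c]) (simp add: eq_diff_eq)
qed

text \<open>The slope b - x of the quadratic has mean b - l/2 over the edge, and it differs from
  this mean by l/2 at either end.\<close>

lemma torsion_edge_normal_derivs:
  assumes "0 < l" and "continuous_on {0..l} w"
    and "weak_deriv 0 l w w1" and "weak_deriv 0 l w1 w2"
    and "AE x in lebesgue_on {0<..<l}. - w2 x = 1"
  shows "normal_deriv_tail l w = (w 0 - w l) / l - l / 2"
    and "normal_deriv_head l w = (w l - w 0) / l - l / 2"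
proof -
  obtain b c where w: "\<And>x. x \<in> {0..l} \<Longrightarrow> w x = b * x + c - x\<^sup>2 / 2"
    using torsion_edge_quadratic[OF assms] by blast
  have deriv_w: "vector_derivative w (at x within {0..l}) = b - x" if "x \<in> {0..l}" for x
  proof (rule vector_derivative_within_closed_interval[OF \<open>0 < l\<close> that])
    have "((\<lambda>x. b * x + c - x\<^sup>2 / 2) has_vector_derivative b - x) (at x within {0..l})"
      by (auto simp flip: has_real_derivative_iff_has_vector_derivative intro!: derivative_eq_intros)
    then show "(w has_vector_derivative b - x) (at x within {0..l})"
      by (rule has_vector_derivative_transform[OF that, rotated]) (simp add: w)
  qed
  have slope: "(w l - w 0) / l = b - l / 2"
    using \<open>0 < l\<close> by (simp add: w field_simps power2_eq_square)
  moreover have "(w 0 - w l) / l = - ((w l - w 0) / l)"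
    by (simp add: minus_divide_left)
  moreover have "normal_deriv_tail l w = - b" "normal_deriv_head l w = b - l"
    using \<open>0 < l\<close> by (simp_all add: normal_deriv_tail_def normal_deriv_head_def deriv_w)
  ultimately show "normal_deriv_tail l w = (w 0 - w l) / l - l / 2"
    and "normal_deriv_head l w = (w l - w 0) / l - l / 2"
    by linarith+
qed

section \<open>From the metric graph to the discrete system\<close>

lemma topspace_graph_topology: "topspace (graph_topology G len) = points G len"
proof
  show "topspace (graph_topology G len) \<subseteq> points G len"
    by (meson openin_graph_topology openin_topspace)
  have "{x \<in> {0..len e}. edge_point G len e x \<in> points G len} = {0..len e}" if "e \<in> arcs G" for e
    using that by (auto simp: points_def)
  then have "openin (graph_topology G len) (points G len)"
    by (simp add: openin_graph_topology)
  then show "points G len \<subseteq> topspace (graph_topology G len)"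
    by (rule openin_subset)
qed

text \<open>Immediate from the quotient topology; it turns continuity on the graph into continuity
  along each closed edge.\<close>

lemma continuous_map_edge_point:
  assumes "e \<in> arcs G"
  shows "continuous_map (top_of_set {0..len e}) (graph_topology G len) (edge_point G len e)"
  using assms
  by (auto simp: continuous_map_def topspace_graph_topology openin_graph_topology points_def)

section \<open>Connectedness, summation over arcs and the discrete system\<close>

context metric_graph
begin

text \<open>The combinatorial form of connectedness: otherwise \<open>A\<close> and its complement,
  each with the edges at its vertices, would split the metric graph into two nonempty open
  sets.\<close>

lemma verts_closed_under_arcs:
  assumes "A \<subseteq> verts G" "A \<noteq> {}"
    and closed: "\<And>e. e \<in> arcs G \<Longrightarrow> tail G e \<in> A \<longleftrightarrow> head G e \<in> A"
  shows "A = verts G"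
proof (rule ccontr)
  assume "A \<noteq> verts G"
  \<comment> \<open>An inner point is assigned to the side of the tail of its edge; for a set closed
    under arcs the head lies on the same side.\<close>
  define U where "U = (\<lambda>B. {p \<in> points G len. case p of Vertex v \<Rightarrow> v \<in> B | Inner e x \<Rightarrow> tail G e \<in> B})"
  have open_U: "openin (graph_topology G len) (U B)"
    if B: "\<And>e. e \<in> arcs G \<Longrightarrow> tail G e \<in> B \<longleftrightarrow> head G e \<in> B" for B
  proof -
    \<comment> \<open>The preimage in an edge is all or nothing, hence relatively open.\<close>
    have "{x \<in> {0..len e}. edge_point G len e x \<in> U B} = (if tail G e \<in> B then {0..len e} else {})"
      if "e \<in> arcs G" for e
      using that B[OF that] by (auto simp: U_def edge_point_def points_def)
    then show ?thesis
      by (simp add: openin_graph_topology) (auto simp: U_def)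
  qed
  have "openin (graph_topology G len) (U A)" "openin (graph_topology G len) (U (- A))"
    using closed by (auto intro!: open_U)
  moreover have "topspace (graph_topology G len) \<subseteq> U A \<union> U (- A)" "U A \<inter> U (- A) = {}"
    by (auto simp: topspace_graph_topology U_def split: point.splits) (metis point.exhaust)
  moreover have "Vertex v \<in> U B" if "v \<in> verts G" "v \<in> B" for v B
    using that by (simp add: U_def points_def)
  then have "U A \<noteq> {}" "U (- A) \<noteq> {}"
    using assms(1,2) \<open>A \<noteq> verts G\<close> by blast+
  ultimately show False
    using connected_graph unfolding connected_space_def by blast
qed

text \<open>This justifies the division in the discrete system. A vertex of degree zero has no
  incident arc, so its singleton would be closed under arcs and leave no room for the second vertex
  \<open>w\<close>.\<close>

lemma metric_degree_pos:
  assumes "v \<in> verts G" "w \<in> verts G" "v \<noteq> w"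
  shows "metric_degree G len v > 0"
proof (rule ccontr)
  assume not_pos: "\<not> metric_degree G len v > 0"
  have nonneg: "(\<Sum>e\<in>out_arcs G v. len e) \<ge> 0" "(\<Sum>e\<in>in_arcs G v. len e) \<ge> 0"
    using len_pos by (auto intro!: sum_nonneg simp: less_imp_le)
  have pos: "(\<Sum>e\<in>E. len e) > 0" if "e \<in> E" "E \<subseteq> arcs G" for e E
    using that by (intro sum_pos2[of E e]) (auto intro: less_imp_le len_pos finite_subset)
  have "tail G e \<noteq> v" "head G e \<noteq> v" if "e \<in> arcs G" for e
  proof -
    have "e \<notin> out_arcs G v"
      using pos[of e "out_arcs G v"] nonneg(2) not_pos by (force simp: metric_degree_def)
    moreover have "e \<notin> in_arcs G v"
      using pos[of e "in_arcs G v"] nonneg(1) not_pos by (force simp: metric_degree_def)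
    ultimately show "tail G e \<noteq> v" "head G e \<noteq> v"
      using that by auto
  qed
  then have "{v} = verts G"
    using assms(1) by (intro verts_closed_under_arcs) auto
  with assms show False by (metis singletonD)
qed

text \<open>Every arc has exactly one tail and one head; a loop contributes both terms at the same
  vertex.\<close>

lemma sum_verts_eq_sum_arcs:
  fixes f g :: "'e \<Rightarrow> real"
  shows "(\<Sum>v\<in>verts G. (\<Sum>e\<in>out_arcs G v. f e) + (\<Sum>e\<in>in_arcs G v. g e)) = (\<Sum>e\<in>arcs G. f e + g e)"
proof -
  have "(\<Sum>v\<in>verts G. \<Sum>e\<in>out_arcs G v. f e) = sum f (arcs G)"
    unfolding out_arcs_def by (rule sum.group) auto
  moreover have "(\<Sum>v\<in>verts G. \<Sum>e\<in>in_arcs G v. g e) = sum g (arcs G)"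
    unfolding in_arcs_def by (rule sum.group) auto
  ultimately show ?thesis by (simp add: sum.distrib)
qed

text \<open>
  Summation by parts turns the pairing of \<open>d\<close> with its graph Laplacian into the Dirichlet energy,
  which therefore vanishes.
\<close>

lemma harmonic_eq_0:
  fixes d :: "'v \<Rightarrow> real"
  assumes VD: "VD \<noteq> {}" "VD \<subseteq> verts G" and zero: "\<And>v. v \<in> VD \<Longrightarrow> d v = 0"
    and harmonic: "\<And>v. v \<in> verts G - VD \<Longrightarrow>
      (\<Sum>e\<in>out_arcs G v. (d v - d (head G e)) / len e) + (\<Sum>e\<in>in_arcs G v. (d v - d (tail G e)) / len e) = 0"
    and "v \<in> verts G"
  shows "d v = 0"
proof -
  have "(\<Sum>e\<in>arcs G. (d (tail G e) - d (head G e))\<^sup>2 / len e)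
      = (\<Sum>e\<in>arcs G. d (tail G e) * ((d (tail G e) - d (head G e)) / len e)
          + d (head G e) * ((d (head G e) - d (tail G e)) / len e))"
    by (intro sum.cong refl) (simp add: power2_eq_square diff_divide_distrib add_divide_distrib algebra_simps)
  also have "\<dots> = (\<Sum>v\<in>verts G. (\<Sum>e\<in>out_arcs G v. d (tail G e) * ((d (tail G e) - d (head G e)) / len e))
          + (\<Sum>e\<in>in_arcs G v. d (head G e) * ((d (head G e) - d (tail G e)) / len e)))"
    by (rule sum_verts_eq_sum_arcs[symmetric])
  also have "\<dots> = (\<Sum>v\<in>verts G. d v * ((\<Sum>e\<in>out_arcs G v. (d v - d (head G e)) / len e)
          + (\<Sum>e\<in>in_arcs G v. (d v - d (tail G e)) / len e)))"
    \<comment> \<open>On \<open>out_arcs G v\<close> the tail is \<open>v\<close>, on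
      \<open>in_arcs G v\<close> the head is \<open>v\<close>, so \<open>d v\<close> factors
      out.\<close>
    by (intro sum.cong refl) (simp add: distrib_left sum_distrib_left)
  also have "\<dots> = 0"
  proof (intro sum.neutral ballI)
    fix v assume "v \<in> verts G"
    then show "d v * ((\<Sum>e\<in>out_arcs G v. (d v - d (head G e)) / len e)
        + (\<Sum>e\<in>in_arcs G v. (d v - d (tail G e)) / len e)) = 0"
      by (cases "v \<in> VD") (simp_all add: zero harmonic)
  qed
  finally have "\<forall>e\<in>arcs G. (d (tail G e) - d (head G e))\<^sup>2 / len e = 0"
    by (subst (asm) sum_nonneg_eq_0_iff) (auto intro!: divide_nonneg_pos len_pos)
  then have "d (tail G e) = d (head G e)" if "e \<in> arcs G" for e
    using that len_pos[OF that] by fastforce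
  \<comment> \<open>Zero energy makes \<open>d\<close> equal at both ends of each arc, so its zero
    set, which contains \<open>VD\<close>, is closed under arcs.\<close>
  then have "{v \<in> verts G. d v = 0} = verts G"
    using VD zero by (intro verts_closed_under_arcs) auto
  with \<open>v \<in> verts G\<close> show ?thesis by blast
qed

text \<open>Summing the edge formulas for the normal derivatives over the arcs at \<open>v\<close>,
  the Kirchhoff condition says that the difference quotients add up to half the metric
  degree.\<close>

lemma torsion_imp_discrete:
  assumes VD: "VD \<noteq> {}" "VD \<subseteq> verts G" and tors: "torsion_function G len VD u"
  shows "discrete_torsion_system G len VD (\<lambda>v. u (Vertex v))"
proof -
  have normal:
    "normal_deriv_tail (len e) (u \<circ> edge_point G len e)
      = (u (Vertex (tail G e)) - u (Vertex (head G e))) / len e - len e / 2"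
    "normal_deriv_head (len e) (u \<circ> edge_point G len e)
      = (u (Vertex (head G e)) - u (Vertex (tail G e))) / len e - len e / 2"
    if e: "e \<in> arcs G" for e
  proof -
    have "continuous_map (top_of_set {0..len e}) euclideanreal (u \<circ> edge_point G len e)"
      using continuous_map_compose continuous_map_edge_point[OF e] tors
      unfolding torsion_function_def by blast
    then have cont: "continuous_on {0..len e} (u \<circ> edge_point G len e)"
      by simp
    obtain w1 w2 where "weak_deriv 0 (len e) (u \<circ> edge_point G len e) w1"
      "weak_deriv 0 (len e) w1 w2" "AE x in lebesgue_on {0<..<len e}. - w2 x = 1"
      using tors e unfolding torsion_function_def by blast
    from torsion_edge_normal_derivs[OF len_pos[OF e] cont this] len_pos[OF e]
    show "normal_deriv_tail (len e) (u \<circ> edge_point G len e)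
        = (u (Vertex (tail G e)) - u (Vertex (head G e))) / len e - len e / 2"
      "normal_deriv_head (len e) (u \<circ> edge_point G len e)
        = (u (Vertex (head G e)) - u (Vertex (tail G e))) / len e - len e / 2"
      by (auto simp: edge_point_def)
  qed
  have "1 / metric_degree G len v *
      ((\<Sum>e\<in>out_arcs G v. (u (Vertex v) - u (Vertex (head G e))) / len e) +
       (\<Sum>e\<in>in_arcs G v. (u (Vertex v) - u (Vertex (tail G e))) / len e)) = 1 / 2"
    (is "_ * (?out + ?in) = _") if v: "v \<in> verts G - VD" for v
  proof -
    have "(\<Sum>e\<in>out_arcs G v. normal_deriv_tail (len e) (u \<circ> edge_point G len e))
        = ?out - (\<Sum>e\<in>out_arcs G v. len e) / 2"
      unfolding sum_divide_distrib sum_subtractf[symmetric] by (intro sum.cong) (auto simp: normal)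
    moreover have "(\<Sum>e\<in>in_arcs G v. normal_deriv_head (len e) (u \<circ> edge_point G len e))
        = ?in - (\<Sum>e\<in>in_arcs G v. len e) / 2"
      unfolding sum_divide_distrib sum_subtractf[symmetric] by (intro sum.cong) (auto simp: normal)
    moreover have "(\<Sum>e\<in>out_arcs G v. normal_deriv_tail (len e) (u \<circ> edge_point G len e))
        + (\<Sum>e\<in>in_arcs G v. normal_deriv_head (len e) (u \<circ> edge_point G len e)) = 0"
      using tors v unfolding torsion_function_def by blast
    ultimately have "?out + ?in = metric_degree G len v / 2"
      unfolding metric_degree_def by argo
    \<comment> \<open>A Dirichlet vertex supplies the second vertex.\<close>
    moreover have "metric_degree G len v > 0"
      using VD v by (auto intro: metric_degree_pos)
    ultimately show ?thesis by simp
  qed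
  then show ?thesis
    using tors unfolding discrete_torsion_system_def torsion_function_def by blast
qed

text \<open>Multiplied by the positive degree, the equations become linear with the same right-hand
  side, so the difference of two solutions is harmonic off \<open>VD\<close> and zero on it.\<close>

lemma discrete_torsion_unique:
  assumes VD: "VD \<noteq> {}" "VD \<subseteq> verts G"
    and g: "discrete_torsion_system G len VD g" and h: "discrete_torsion_system G len VD h"
    and "v \<in> verts G"
  shows "h v = g v"
proof -
  have balance: "(\<Sum>e\<in>out_arcs G v. (k v - k (head G e)) / len e)
      + (\<Sum>e\<in>in_arcs G v. (k v - k (tail G e)) / len e) = metric_degree G len v / 2"
    if "discrete_torsion_system G len VD k" "v \<in> verts G - VD" for k v
  proof -
    have "metric_degree G len v > 0"
      using VD that(2) by (auto intro: metric_degree_pos)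
    with that show ?thesis
      by (auto simp: discrete_torsion_system_def field_simps)
  qed
  have "h v - g v = 0"
  proof (rule harmonic_eq_0[OF VD _ _ \<open>v \<in> verts G\<close>])
    show "h v - g v = 0" if "v \<in> VD" for v
      using that g h by (simp add: discrete_torsion_system_def)
    fix v assume v: "v \<in> verts G - VD"
    have diff: "((h v - g v) - (h x - g x)) / c = (h v - h x) / c - (g v - g x) / c" for x c
      by (simp add: diff_divide_distrib)
    show "(\<Sum>e\<in>out_arcs G v. ((h v - g v) - (h (head G e) - g (head G e))) / len e)
        + (\<Sum>e\<in>in_arcs G v. ((h v - g v) - (h (tail G e) - g (tail G e))) / len e) = 0"
      unfolding diff sum_subtractf using balance[OF g v] balance[OF h v] by linarith
  qed
  then show ?thesis by simp
qed

end

text \<open>Uniqueness is stated on \<open>verts G\<close>, since the system does not constrain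
  values of \<open>h\<close> elsewhere.\<close>

theorem proposition3p1:
  fixes G :: "('v, 'e) pre_digraph"
    and len :: "'e \<Rightarrow> real"
    and VD :: "'v set"
    and u :: "('v, 'e) point \<Rightarrow> real"
  assumes "metric_graph G len"
    and "VD \<noteq> {}" and "VD \<subseteq> verts G"
    and "torsion_function G len VD u"
  shows "discrete_torsion_system G len VD (\<lambda>v. u (Vertex v)) \<and>
    (\<forall>h. discrete_torsion_system G len VD h \<longrightarrow> (\<forall>v\<in>verts G. h v = u (Vertex v)))"
  using metric_graph.torsion_imp_discrete[OF assms]
    metric_graph.discrete_torsion_unique[OF assms(1-3)] by blast

end
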